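(* Let $T\ge1$ and fix convention E ($\varepsilon=0$) or N ($\varepsilon=1$). For every deterministic learner $\mathcal A$ there exist an admissible total order $\preceq^\star$ on $X$, a point $z^\star\in X$, and a function $O^\star:2^{X\times\{0,1\}}\to C_{\preceq^\star}\cup\{\bot\}$ which is a legal consistency-type ERM oracle on every sample and depends on the sample only, such that on this fixed instance (order $\preceq^\star$, target $c_{z^\star}$, oracle $O^\star$) $$M(\mathcal A)+Q(\mathcal A)\ \ge\ T-\varepsilon .$$ The constant cannot be improved uniformly over $T\ge1$: for neither convention does the statement hold for all $T\ge1$ with $\varepsilon$ replaced by a smaller number.
   Context: Domain and conventions. $T$ distinct instances are announced in advance as a sequence $x_1,\dots,x_T$. Convention E: $X=\{s,x_1,\dots,x_T\}$ and only total orders on $X$ in which the sentinel $s$ is the minimum are admissible. Convention N: $X=\{x_1,\dots,x_T\}$, all total orders on $X$ are admissible. For a total order $\preceq$ on $X$ and $z\in X$ let $c_z(x)=\mathbf 1[x\preceq z]$ and $C_\preceq=\{c_z:z\in X\}$. Oracle. $O$ is a legal consistency-type ERM oracle for $\preceq$ if for every sample $S\subseteq X\times\{0,1\}$, $O(S)$ is a concept of $C_\preceq$ consistent with $S$ (given to the learner as a full label vector on $X$) if one exists, and $\bot$ otherwise. Protocol. The learner knows the convention, $X$, $T$ and the sequence, but not $\preceq$, $z$ or the oracle function. In round $t$ it predicts $\hat y_t\in\{0,1\}$ and then sees $y_t=c_z(x_t)$; at any time it may call the oracle on any adaptively chosen sample (contradictory samples allowed), each call costing one. The learner is deterministic: each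 action is a function of the history. $M$ is the number of mistakes, $Q$ the number of oracle calls. *)

theory Defs
  imports Complex_Main "HOL-Library.Extended_Real"
begin

datatype 'a convention = Conv_E 'a | Conv_N

text \<open>The argument of \<open>Conv_E\<close> is the sentinel. The announced sequence is \<open>x 1, \<dots>, x T\<close>;
  the value \<open>x 0\<close> plays no role.\<close>

fun instance_space :: "'a convention \<Rightarrow> (nat \<Rightarrow> 'a) \<Rightarrow> nat \<Rightarrow> 'a set" where
  "instance_space (Conv_E s) x T = insert s (x ` {1..T})"
| "instance_space Conv_N x T = x ` {1..T}"

fun distinct_instances :: "'a convention \<Rightarrow> (nat \<Rightarrow> 'a) \<Rightarrow> nat \<Rightarrow> bool" where
  "distinct_instances (Conv_E s) x T \<longleftrightarrow> inj_on x {1..T} \<and> s \<notin> x ` {1..T}"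
| "distinct_instances Conv_N x T \<longleftrightarrow> inj_on x {1..T}"

text \<open>A total order is a relation \<open>r \<subseteq> X \<times> X\<close>, with \<open>(a, b) \<in> r\<close> meaning that \<open>a\<close> precedes or
  equals \<open>b\<close>.\<close>

fun admissible_order :: "'a convention \<Rightarrow> (nat \<Rightarrow> 'a) \<Rightarrow> nat \<Rightarrow> 'a rel \<Rightarrow> bool" where
  "admissible_order (Conv_E s) x T r \<longleftrightarrow>
     linear_order_on (instance_space (Conv_E s) x T) r \<and>
     (\<forall>a \<in> instance_space (Conv_E s) x T. (s, a) \<in> r)"
| "admissible_order Conv_N x T r \<longleftrightarrow> linear_order_on (instance_space Conv_N x T) r"

fun slack :: "'a convention \<Rightarrow> real" where
  "slack (Conv_E s) = 0"
| "slack Conv_N = 1"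

text \<open>Since \<open>r \<subseteq> X \<times> X\<close>, a concept is \<open>False\<close> outside \<open>X\<close>, so as a function on the whole type
  it carries the same information as its label vector on \<open>X\<close>.\<close>

definition concept :: "'a rel \<Rightarrow> 'a \<Rightarrow> 'a \<Rightarrow> bool" where
  "concept r z = (\<lambda>a. (a, z) \<in> r)"

definition concept_class :: "'a set \<Rightarrow> 'a rel \<Rightarrow> ('a \<Rightarrow> bool) set" where
  "concept_class X r = concept r ` X"

type_synonym 'a sample = "('a \<times> bool) set"

definition consistent :: "('a \<Rightarrow> bool) \<Rightarrow> 'a sample \<Rightarrow> bool" where
  "consistent c S \<longleftrightarrow> (\<forall>(a, y) \<in> S. c a = y)"

type_synonym 'a erm_oracle = "'a sample \<Rightarrow> ('a \<Rightarrow> bool) option"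

definition legal_oracle :: "'a set \<Rightarrow> 'a rel \<Rightarrow> 'a erm_oracle \<Rightarrow> bool" where
  "legal_oracle X r Orc \<longleftrightarrow>
     (\<forall>S \<subseteq> X \<times> UNIV.
        if \<exists>c \<in> concept_class X r. consistent c S
        then \<exists>c \<in> concept_class X r. consistent c S \<and> Orc S = Some c
        else Orc S = None)"

text \<open>A history lists, in chronological order, the completed rounds (prediction, revealed label)
  and the oracle calls (sample, answer).\<close>

datatype 'a event = Round bool bool | Call "'a sample" "('a \<Rightarrow> bool) option"

datatype 'a action = Predict bool | Query "'a sample"

type_synonym 'a learner = "'a event list \<Rightarrow> 'a action"

definition valid_learner :: "'a set \<Rightarrow> 'a learner \<Rightarrow> bool" where
  "valid_learner X A \<longleftrightarrow> (\<forall>h S. A h = Query S \<longrightarrow> S \<subseteq> X \<times> UNIV)"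

fun is_round :: "'a event \<Rightarrow> bool" where
  "is_round (Round p y) = True"
| "is_round (Call S a) = False"

fun is_mistake :: "'a event \<Rightarrow> bool" where
  "is_mistake (Round p y) = (p \<noteq> y)"
| "is_mistake (Call S a) = False"

definition rounds :: "'a event list \<Rightarrow> nat" where
  "rounds h = length (filter is_round h)"

definition mistakes :: "'a event list \<Rightarrow> nat" where
  "mistakes h = length (filter is_mistake h)"

definition calls :: "'a event list \<Rightarrow> nat" where
  "calls h = length (filter (\<lambda>e. \<not> is_round e) h)"

text \<open>Oracle calls are possible before every prediction and also after the last label has been
  revealed; once all \<open>T\<close> rounds are over, a \<open>Predict\<close> action leaves the history unchanged, i.e. it
  ends the interaction.\<close>

definition step ::
  "(nat \<Rightarrow> 'a) \<Rightarrow> nat \<Rightarrow> ('a \<Rightarrow> bool) \<Rightarrow> 'a erm_oracle \<Rightarrow> 'a learner \<Rightarrow> 'a event list \<Rightarrow> 'a event list"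
where
  "step x T c Orc A h =
     (case A h of
        Query S \<Rightarrow> h @ [Call S (Orc S)]
      | Predict p \<Rightarrow> if rounds h < T then h @ [Round p (c (x (Suc (rounds h))))] else h)"

definition run ::
  "(nat \<Rightarrow> 'a) \<Rightarrow> nat \<Rightarrow> ('a \<Rightarrow> bool) \<Rightarrow> 'a erm_oracle \<Rightarrow> 'a learner \<Rightarrow> nat \<Rightarrow> 'a event list"
where
  "run x T c Orc A n = (step x T c Orc A ^^ n) []"

text \<open>The totals are extended naturals because a learner may go on calling the oracle forever.\<close>

definition total_mistakes ::
  "(nat \<Rightarrow> 'a) \<Rightarrow> nat \<Rightarrow> ('a \<Rightarrow> bool) \<Rightarrow> 'a erm_oracle \<Rightarrow> 'a learner \<Rightarrow> enat"
where
  "total_mistakes x T c Orc A = (SUP n. enat (mistakes (run x T c Orc A n)))"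

definition total_calls ::
  "(nat \<Rightarrow> 'a) \<Rightarrow> nat \<Rightarrow> ('a \<Rightarrow> bool) \<Rightarrow> 'a erm_oracle \<Rightarrow> 'a learner \<Rightarrow> enat"
where
  "total_calls x T c Orc A = (SUP n. enat (calls (run x T c Orc A n)))"

definition lower_bound :: "'a convention \<Rightarrow> (nat \<Rightarrow> 'a) \<Rightarrow> nat \<Rightarrow> real \<Rightarrow> bool" where
  "lower_bound conv x T \<epsilon> \<longleftrightarrow>
     (\<forall>A. valid_learner (instance_space conv x T) A \<longrightarrow>
        (\<exists>r z Orc.
           admissible_order conv x T r \<and>
           z \<in> instance_space conv x T \<and>
           legal_oracle (instance_space conv x T) r Orc \<and>
           ereal_of_enat (total_mistakes x T (concept r z) Orc A
                          + total_calls x T (concept r z) Orc A)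
             \<ge> ereal (real T - \<epsilon>)))"

end

theory Submission
  imports Defs
begin

text \<open>The adversary keeps the instances that are still undetermined in a set \<open>F\<close>, placed as an
  unordered block between a list \<open>L\<close> of instances already declared positive and a list \<open>H\<close> of
  instances already declared negative. The oracle always answers with the largest consistent concept.
  An instance of \<open>F\<close> whose label is requested gets the label opposite to the prediction and becomes
  the top of \<open>L\<close> or the bottom of \<open>H\<close>. If a sample labels some \<open>g \<in> F\<close> negatively, then \<open>g\<close> is made
  the top of \<open>L\<close>, after which the largest consistent concept no longer depends on how \<open>F\<close> is ordered.
  So an instance leaves \<open>F\<close> only at the price of a mistake or a call. The list \<open>L\<close> must start nonempty:
  it holds the sentinel in convention E, and in convention N one instance is given up for it.\<close>

section \<open>Orders given by lists and the oracle with maximal answers\<close>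

definition list_order :: "'a list \<Rightarrow> 'a rel" where
  "list_order w = {(w ! i, w ! j) | i j. i \<le> j \<and> j < length w}"

text \<open>The list \<open>d\<close> is the longest initial segment of \<open>w\<close> without a
  negatively labelled instance. The empty segment is excluded because every concept contains its own
  threshold point.\<close>

definition max_oracle :: "'a list \<Rightarrow> 'a erm_oracle" where
  "max_oracle w S =
     (let d = takeWhile (\<lambda>a. (a, False) \<notin> S) w
      in if d \<noteq> [] \<and> (\<forall>a. (a, True) \<in> S \<longrightarrow> a \<in> set d) then Some (\<lambda>a. a \<in> set d) else None)"

text \<open>A completion fixes both the final order \<open>u @ v\<close> and the target:
  \<open>u\<close> holds the positives and \<open>v\<close> the negatives. The lists
  \<open>m1\<close> and \<open>m2\<close> split and order the block \<open>F\<close>, which stays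
  free until then.\<close>

definition completes :: "'a list \<Rightarrow> 'a set \<Rightarrow> 'a list \<Rightarrow> 'a list \<Rightarrow> 'a list \<Rightarrow> bool" where
  "completes L F H u v \<longleftrightarrow>
     (\<exists>m1 m2. u = L @ m1 \<and> v = m2 @ H \<and> set m1 \<union> set m2 = F \<and> distinct (u @ v))"

lemma linear_order_on_list_order:
  assumes "distinct w"
  shows "linear_order_on (set w) (list_order w)"
proof -
  have eq: "w ! i = w ! j \<longleftrightarrow> i = j" if "i < length w" "j < length w" for i j
    using assms that nth_eq_iff_index_eq by blast
  have "refl_on (set w) (list_order w)"
    unfolding refl_on_def list_order_def by (auto simp: set_conv_nth)
  moreover have "list_order w \<subseteq> set w \<times> set w"
    by (auto simp: list_order_def)
  moreover have "trans (list_order w)"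
  proof (rule transI)
    fix a b c assume "(a, b) \<in> list_order w" "(b, c) \<in> list_order w"
    then obtain i j k l where "a = w ! i" "b = w ! j" "i \<le> j" "j < length w"
      "b = w ! k" "c = w ! l" "k \<le> l" "l < length w"
      by (auto simp: list_order_def)
    moreover from this have "j = k" using eq[of j k] by simp
    ultimately have "a = w ! i" "c = w ! l" "i \<le> l" "l < length w" by simp_all
    then show "(a, c) \<in> list_order w"
      unfolding list_order_def by blast
  qed
  moreover have "antisym (list_order w)"
    by (rule antisymI) (auto simp: list_order_def eq)
  moreover have "total_on (set w) (list_order w)"
  proof (rule total_onI)
    fix a b assume "a \<in> set w" "b \<in> set w"
    then obtain i j where "i < length w" "a = w ! i" "j < length w" "b = w ! j"
      unfolding in_set_conv_nth by blast
    then show "(a, b) \<in> list_order w \<or> (b, a) \<in> list_order w"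
      using nat_le_linear[of i j] unfolding list_order_def by blast
  qed
  ultimately show ?thesis
    unfolding linear_order_on_def partial_order_on_def preorder_on_def by blast
qed

lemma concept_list_order:
  assumes "distinct w" "j < length w"
  shows "concept (list_order w) (w ! j) = (\<lambda>a. a \<in> set (take (Suc j) w))"
proof
  fix a
  show "concept (list_order w) (w ! j) a = (a \<in> set (take (Suc j) w))"
  proof
    assume "concept (list_order w) (w ! j) a"
    then obtain i k where "a = w ! i" "w ! j = w ! k" "i \<le> k" "k < length w"
      by (auto simp: concept_def list_order_def)
    moreover from this have "k = j" using assms nth_eq_iff_index_eq by metis
    ultimately show "a \<in> set (take (Suc j) w)"
      by (auto simp: in_set_conv_nth intro!: exI[of _ i])
  next
    assume "a \<in> set (take (Suc j) w)"
    then obtain i where "i < Suc j" "a = w ! i"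
      by (auto simp: in_set_conv_nth)
    moreover from this have "i \<le> j" by simp
    ultimately show "concept (list_order w) (w ! j) a"
      using assms(2) unfolding concept_def list_order_def by blast
  qed
qed

lemma concept_class_list_order:
  assumes "distinct w"
  shows "concept_class (set w) (list_order w) =
    {\<lambda>a. a \<in> set d | d e. w = d @ e \<and> d \<noteq> []}" (is "?C = ?D")
proof
  show "?C \<subseteq> ?D"
  proof
    fix c assume "c \<in> ?C"
    then obtain j where j: "j < length w" "c = concept (list_order w) (w ! j)"
      by (auto simp: concept_class_def in_set_conv_nth)
    then have "c = (\<lambda>a. a \<in> set (take (Suc j) w))"
      using concept_list_order[OF assms] by simp
    moreover have "w = take (Suc j) w @ drop (Suc j) w" "take (Suc j) w \<noteq> []"
      using j by auto
    ultimately show "c \<in> ?D" by blast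
  qed
next
  show "?D \<subseteq> ?C"
  proof
    fix c assume "c \<in> ?D"
    then obtain d e where de: "w = d @ e" "d \<noteq> []" "c = (\<lambda>a. a \<in> set d)"
      by blast
    then have j: "length d - 1 < length w" by (cases d) auto
    have "take (Suc (length d - 1)) w = d" using de by (cases d) auto
    then have "c = concept (list_order w) (w ! (length d - 1))"
      using concept_list_order[OF assms j] de(3) by simp
    then show "c \<in> ?C"
      unfolding concept_class_def using nth_mem[OF j] by blast
  qed
qed

text \<open>A consistent concept is an initial segment free of negatives, hence lies inside the
  longest such segment \<open>d\<close>. So if any concept covers the positive labels,
  \<open>d\<close> covers them too.\<close>

lemma legal_max_oracle:
  assumes "distinct w"
  shows "legal_oracle (set w) (list_order w) (max_oracle w)"
  unfolding legal_oracle_def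
proof (intro allI impI)
  fix S :: "'a sample"
  define d where "d = takeWhile (\<lambda>a. (a, False) \<notin> S) w"
  have orc: "max_oracle w S =
    (if d \<noteq> [] \<and> (\<forall>a. (a, True) \<in> S \<longrightarrow> a \<in> set d) then Some (\<lambda>a. a \<in> set d) else None)"
    by (simp add: max_oracle_def d_def Let_def)
  let ?C = "concept_class (set w) (list_order w)"
  have neg: "(a, False) \<notin> S" if "a \<in> set d" for a
    using that by (auto simp: d_def dest: set_takeWhileD)
  have w: "w = d @ dropWhile (\<lambda>a. (a, False) \<notin> S) w"
    by (simp add: d_def)
  have good: "d \<noteq> [] \<and> (\<forall>a. (a, True) \<in> S \<longrightarrow> a \<in> set d)"
    if "c \<in> ?C" "consistent c S" for c
  proof -
    obtain p e where p: "w = p @ e" "p \<noteq> []" "c = (\<lambda>a. a \<in> set p)"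
      using \<open>c \<in> ?C\<close> concept_class_list_order[OF assms] by auto
    have "\<forall>a\<in>set p. (a, False) \<notin> S" "\<forall>a. (a, True) \<in> S \<longrightarrow> a \<in> set p"
      using \<open>consistent c S\<close> p by (auto simp: consistent_def)
    moreover from this have "d = p @ takeWhile (\<lambda>a. (a, False) \<notin> S) e"
      unfolding d_def p(1) by (intro takeWhile_append2) auto
    ultimately show ?thesis using p by auto
  qed
  show "if \<exists>c\<in>?C. consistent c S then \<exists>c\<in>?C. consistent c S \<and> max_oracle w S = Some c
        else max_oracle w S = None"
  proof (cases "d \<noteq> [] \<and> (\<forall>a. (a, True) \<in> S \<longrightarrow> a \<in> set d)")
    case True
    then have "(\<lambda>a. a \<in> set d) \<in> ?C"
      using w concept_class_list_order[OF assms] by auto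
    moreover have "consistent (\<lambda>a. a \<in> set d) S"
      unfolding consistent_def
    proof (intro ballI, clarify)
      fix a y assume "(a, y) \<in> S"
      then show "(a \<in> set d) = y" using True neg by (cases y) auto
    qed
    ultimately show ?thesis using True orc by auto
  next
    case False
    then show ?thesis using good orc by auto
  qed
qed

text \<open>The scan for the first negative label either stops inside the fixed list
  \<open>L\<close>, or passes the whole block and stops in \<open>H\<close> or at the end. In both
  cases the answer contains all of \<open>F\<close> or nothing of it, so the arrangement of
  \<open>F\<close> is invisible.\<close>

lemma max_oracle_completes:
  assumes "completes L F H u v" "completes L F H u' v'"
    and "(\<exists>g\<in>set L. (g, False) \<in> S) \<or> (\<forall>g\<in>F. (g, False) \<notin> S)"
  shows "max_oracle (u @ v) S = max_oracle (u' @ v') S"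
proof -
  let ?P = "\<lambda>a. (a, False) \<notin> S"
  obtain m where m: "u @ v = L @ m @ H" "set m = F"
    using assms(1) unfolding completes_def by (metis append.assoc set_append)
  obtain m' where m': "u' @ v' = L @ m' @ H" "set m' = F"
    using assms(2) unfolding completes_def by (metis append.assoc set_append)
  \<comment> \<open>The two segments may differ as lists, but the answer depends only on their sets
    of elements.\<close>
  have "set (takeWhile ?P (u @ v)) = set (takeWhile ?P (u' @ v'))"
  proof (cases "\<exists>g\<in>set L. (g, False) \<in> S")
    case True
    then obtain g where "g \<in> set L" "\<not> ?P g" by blast
    then have "takeWhile ?P (L @ ys) = takeWhile ?P L" for ys
      by (intro takeWhile_append1) auto
    then show ?thesis using m(1) m'(1) by simp
  next
    case False
    then have "takeWhile ?P (ys @ H) = ys @ takeWhile ?P H" if "set ys = set L \<union> F" for ys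
      using that assms(3) by (intro takeWhile_append2) auto
    from this[of "L @ m"] this[of "L @ m'"] have
      "takeWhile ?P (u @ v) = L @ m @ takeWhile ?P H"
      "takeWhile ?P (u' @ v') = L @ m' @ takeWhile ?P H"
      using m m' by simp_all
    then show ?thesis using m m' by simp
  qed
  moreover from this have "takeWhile ?P (u @ v) = [] \<longleftrightarrow> takeWhile ?P (u' @ v') = []"
    by (metis set_empty)
  ultimately show ?thesis
    unfolding max_oracle_def Let_def by presburger
qed

section \<open>Refining a configuration\<close>

lemma completes_snoc:
  assumes "completes (L @ [g]) (F - {g}) H u v" "g \<in> F"
  shows "completes L F H u v"
proof -
  obtain m1 m2 where "u = (L @ [g]) @ m1" "v = m2 @ H" "set m1 \<union> set m2 = F - {g}" "distinct (u @ v)"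
    using assms(1) unfolding completes_def by blast
  then have "u = L @ (g # m1) \<and> v = m2 @ H \<and> set (g # m1) \<union> set m2 = F \<and> distinct (u @ v)"
    using assms(2) by auto
  then show ?thesis unfolding completes_def by blast
qed

text \<open>As with \<open>completes_snoc\<close>, committing an instance only narrows the set of
  completions, so whatever completion is found later also fits the earlier configuration.\<close>

lemma completes_Cons:
  assumes "completes L (F - {g}) (g # H) u v" "g \<in> F"
  shows "completes L F H u v"
proof -
  obtain m1 m2 where "u = L @ m1" "v = m2 @ g # H" "set m1 \<union> set m2 = F - {g}" "distinct (u @ v)"
    using assms(1) unfolding completes_def by blast
  then have "u = L @ m1 \<and> v = (m2 @ [g]) @ H \<and> set m1 \<union> set (m2 @ [g]) = F \<and> distinct (u @ v)"
    using assms(2) by auto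
  then show ?thesis unfolding completes_def by blast
qed

lemma completes_set:
  assumes "completes L F H u v"
  shows "set L \<subseteq> set u" "set H \<subseteq> set v" "set u \<inter> set v = {}" "set (u @ v) = set L \<union> F \<union> set H"
  using assms by (auto simp: completes_def)

lemma completes_exists:
  assumes "finite F" "distinct (L @ H)" "F \<inter> set (L @ H) = {}"
  obtains u v where "completes L F H u v"
proof -
  obtain m where "set m = F" "distinct m" using assms(1) finite_distinct_list by blast
  \<comment> \<open>Any arrangement would do; here the whole block goes to the negative
    side.\<close>
  then have "completes L F H L (m @ H)"
    using assms unfolding completes_def by auto
  then show ?thesis using that by blast
qed

section \<open>The adaptive adversary\<close>

lemma counts_append [simp]:
  "mistakes (h @ h') = mistakes h + mistakes h'"
  "calls (h @ h') = calls h + calls h'"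
  "rounds (h @ h') = rounds h + rounds h'"
  by (simp_all add: mistakes_def calls_def rounds_def)

lemma counts_simps [simp]:
  "mistakes [] = 0" "calls [] = 0" "rounds [] = 0"
  "mistakes [Round p y] = (if p \<noteq> y then 1 else 0)" "calls [Round p y] = 0" "rounds [Round p y] = 1"
  "mistakes [Call S a] = 0" "calls [Call S a] = 1" "rounds [Call S a] = 0"
  by (simp_all add: mistakes_def calls_def rounds_def)

text \<open>Each event gets an answer shared by all completions of the configuration that follows
  it, so the fixed instance chosen at the end reproduces the whole history. The number
  \<open>K\<close> is the cost to be forced; the invariant survives because
  \<open>mistakes h + calls h + card F\<close> never decreases.\<close>

lemma adversary:
  fixes A :: "'a learner"
  assumes "finite F" "distinct (L @ H)" "F \<inter> set (L @ H) = {}"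
    and "F \<subseteq> x ` {Suc (rounds h)..T}" "x ` {1..T} \<subseteq> set L \<union> F \<union> set H"
    and "K \<le> mistakes h + calls h + card F"
    and "rounds h \<le> T"
  shows "\<exists>u v n. completes L F H u v \<and>
    K \<le> mistakes ((step x T (\<lambda>a. a \<in> set u) (max_oracle (u @ v)) A ^^ n) h) +
        calls ((step x T (\<lambda>a. a \<in> set u) (max_oracle (u @ v)) A ^^ n) h)"
    (is "\<exists>u v n. _ \<and> K \<le> ?cost u v n h")
  using assms
\<comment> \<open>Calls are unlimited, so rounds alone give no termination. The second summand drops
  at every call made while the cost, and hence the number of calls, is still below
  \<open>K\<close>.\<close>
proof (induction "(T - rounds h) + (K - calls h)" arbitrary: h L F H rule: less_induct)
  case less
  note fin = less.prems(1) and dist = less.prems(2) and disj = less.prems(3)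
    and F = less.prems(4) and X = less.prems(5) and K = less.prems(6)
  show ?case
  proof (cases "K \<le> mistakes h + calls h")
    case True
    obtain u v where "completes L F H u v"
      using completes_exists[OF fin dist disj] .
    then show ?thesis using True by (intro exI[of _ u] exI[of _ v] exI[of _ 0]) simp
  next
    case False
    \<comment> \<open>The cost is still below \<open>K\<close>, so some undetermined instance
      remains; it lies among the future instances, so the rounds are not over.\<close>
    then have "F \<noteq> {}" using K by auto
    then have "{Suc (rounds h)..T} \<noteq> {}" using F by blast
    then have lt: "rounds h < T" by simp
    \<comment> \<open>One move of the game: if all completions of the refined configuration lead
      from \<open>h\<close> to the same history \<open>h'\<close>, then a completion forcing the
      cost from \<open>h'\<close> also forces it from \<open>h\<close>, with one more step.\<close>
    have advance: ?thesis
      if IH: "\<exists>u v n. completes L' F' H' u v \<and> K \<le> ?cost u v n h'"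
        and st: "\<And>u v. completes L' F' H' u v \<Longrightarrow> completes L F H u v \<and>
          step x T (\<lambda>a. a \<in> set u) (max_oracle (u @ v)) A h = h'"
      for h' L' F' H'
    proof -
      obtain u v n where uvn: "completes L' F' H' u v" "K \<le> ?cost u v n h'"
        using IH by blast
      have "(step x T (\<lambda>a. a \<in> set u) (max_oracle (u @ v)) A ^^ Suc n) h =
        (step x T (\<lambda>a. a \<in> set u) (max_oracle (u @ v)) A ^^ n) h'"
        using st[OF uvn(1)] by (simp only: funpow_Suc_right comp_apply)
      then have "K \<le> ?cost u v (Suc n) h"
        using uvn(2) by (simp only:)
      moreover have "completes L F H u v" using st[OF uvn(1)] ..
      ultimately show ?thesis by blast
    qed
    show ?thesis
    proof (cases "A h")
      case (Predict p)
      define a where "a = x (Suc (rounds h))"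
      have stp: "step x T (\<lambda>a. a \<in> set u) orc A h = h @ [Round p (a \<in> set u)]" for u orc
        using Predict lt by (simp add: step_def a_def)
      have Fa: "F - {a} \<subseteq> x ` {Suc (Suc (rounds h))..T}"
      proof
        fix b assume "b \<in> F - {a}"
        then obtain i where i: "b = x i" "Suc (rounds h) \<le> i" "i \<le> T" "x i \<noteq> a" using F by auto
        then have "i \<noteq> Suc (rounds h)" by (auto simp: a_def)
        then show "b \<in> x ` {Suc (Suc (rounds h))..T}" using i by auto
      qed
      show ?thesis
      proof (cases "a \<in> F")
        case aF: True
        then have K': "K \<le> mistakes h + calls h + Suc (card (F - {a}))"
          using K card_Suc_Diff1[OF fin] by metis
        show ?thesis
        proof (cases p)
          case True
          show ?thesis
          proof (rule advance)
            show "\<exists>u v n. completes L (F - {a}) (a # H) u v \<and> K \<le> ?cost u v n (h @ [Round p False])"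
              using fin dist disj Fa X K' lt aF True
              by (intro less.hyps) auto
            fix u v assume c: "completes L (F - {a}) (a # H) u v"
            then have "a \<notin> set u" using completes_set[OF c] by auto
            then show "completes L F H u v \<and>
              step x T (\<lambda>a. a \<in> set u) (max_oracle (u @ v)) A h = h @ [Round p False]"
              using completes_Cons[OF c aF] stp by simp
          qed
        next
          case False
          show ?thesis
          proof (rule advance)
            show "\<exists>u v n. completes (L @ [a]) (F - {a}) H u v \<and> K \<le> ?cost u v n (h @ [Round p True])"
              using fin dist disj Fa X K' lt aF False
              by (intro less.hyps) auto
            fix u v assume c: "completes (L @ [a]) (F - {a}) H u v"
            then have "a \<in> set u" using completes_set[OF c] by auto
            then show "completes L F H u v \<and>
              step x T (\<lambda>a. a \<in> set u) (max_oracle (u @ v)) A h = h @ [Round p True]"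
              using completes_snoc[OF c aF] stp by simp
          qed
        qed
      next
        \<comment> \<open>The label of \<open>a\<close> was committed earlier. All completions agree
          on it, and \<open>F\<close> is unchanged whether or not the prediction is correct.\<close>
        case aF: False
        have "a \<in> x ` {1..T}" using lt by (auto simp: a_def)
        then have aX: "a \<in> set L \<union> set H" using X aF by blast
        show ?thesis
        proof (rule advance)
          show "\<exists>u v n. completes L F H u v \<and> K \<le> ?cost u v n (h @ [Round p (a \<in> set L)])"
            using fin dist disj Fa X K lt aF
            by (intro less.hyps) auto
          fix u v assume c: "completes L F H u v"
          then have "a \<in> set u \<longleftrightarrow> a \<in> set L" using completes_set[OF c] aX by auto
          then show "completes L F H u v \<and>
            step x T (\<lambda>a. a \<in> set u) (max_oracle (u @ v)) A h = h @ [Round p (a \<in> set L)]"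
            using c stp by simp
        qed
      qed
    next
      case (Query S)
      have stp: "step x T c orc A h = h @ [Call S (orc S)]" for c orc
        using Query by (simp add: step_def)
      show ?thesis
      proof (cases "\<exists>g\<in>F. (g, False) \<in> S")
        case True
        then obtain g where g: "g \<in> F" "(g, False) \<in> S" by blast
        then have K': "K \<le> mistakes h + calls h + Suc (card (F - {g}))"
          using K card_Suc_Diff1[OF fin] by metis
        have inv: "finite (F - {g})" "distinct ((L @ [g]) @ H)" "(F - {g}) \<inter> set ((L @ [g]) @ H) = {}"
          using fin dist disj g by auto
        \<comment> \<open>This completion only serves to name the answer. With the negatively
          labelled \<open>g\<close> now in \<open>L\<close>, all other completions give the same
          one.\<close>
        obtain u0 v0 where c0: "completes (L @ [g]) (F - {g}) H u0 v0"
          using completes_exists[OF inv] .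
        show ?thesis
        proof (rule advance)
          show "\<exists>u v n. completes (L @ [g]) (F - {g}) H u v \<and>
            K \<le> ?cost u v n (h @ [Call S (max_oracle (u0 @ v0) S)])"
            using inv F X K' lt g False
            by (intro less.hyps) auto
          fix u v assume c: "completes (L @ [g]) (F - {g}) H u v"
          then have "max_oracle (u @ v) S = max_oracle (u0 @ v0) S"
            using c0 g by (intro max_oracle_completes) auto
          then show "completes L F H u v \<and> step x T (\<lambda>a. a \<in> set u) (max_oracle (u @ v)) A h =
            h @ [Call S (max_oracle (u0 @ v0) S)]"
            using completes_snoc[OF c g(1)] stp by simp
        qed
      next
        \<comment> \<open>No negative label falls in \<open>F\<close>, so the answer is already
          determined: the call costs the learner one and no instance leaves
          \<open>F\<close>.\<close>
        case noneg: False
        obtain u0 v0 where c0: "completes L F H u0 v0"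
          using completes_exists[OF fin dist disj] .
        show ?thesis
        proof (rule advance)
          show "\<exists>u v n. completes L F H u v \<and>
            K \<le> ?cost u v n (h @ [Call S (max_oracle (u0 @ v0) S)])"
            using fin dist disj F X K lt False
            by (intro less.hyps) auto
          fix u v assume c: "completes L F H u v"
          then have "max_oracle (u @ v) S = max_oracle (u0 @ v0) S"
            using c0 noneg by (intro max_oracle_completes) auto
          then show "completes L F H u v \<and> step x T (\<lambda>a. a \<in> set u) (max_oracle (u @ v)) A h =
            h @ [Call S (max_oracle (u0 @ v0) S)]"
            using c stp by simp
        qed
      qed
    qed
  qed
qed

text \<open>Common core of both conventions: \<open>s\<close> is the least element, so the initial
  list is \<open>[s]\<close>, and every other instance costs the learner one.\<close>

lemma adversary_instance:
  fixes A :: "'a learner"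
  assumes "x ` {1..T} \<subseteq> insert s F" "F \<subseteq> x ` {1..T}" "s \<notin> F"
  shows "\<exists>r z Orc. linear_order_on (insert s F) r \<and> (\<forall>a\<in>insert s F. (s, a) \<in> r) \<and>
    z \<in> insert s F \<and> legal_oracle (insert s F) r Orc \<and>
    enat (card F) \<le> total_mistakes x T (concept r z) Orc A + total_calls x T (concept r z) Orc A"
proof -
  have "finite F" using assms(2) finite_surj by blast
  then have "\<exists>u v n. completes [s] F [] u v \<and>
    card F \<le> mistakes ((step x T (\<lambda>a. a \<in> set u) (max_oracle (u @ v)) A ^^ n) []) +
        calls ((step x T (\<lambda>a. a \<in> set u) (max_oracle (u @ v)) A ^^ n) [])"
    using assms by (intro adversary) auto
  then obtain u v n where c: "completes [s] F [] u v" and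
    cost: "card F \<le> mistakes (run x T (\<lambda>a. a \<in> set u) (max_oracle (u @ v)) A n) +
        calls (run x T (\<lambda>a. a \<in> set u) (max_oracle (u @ v)) A n)"
    by (auto simp: run_def)
  \<comment> \<open>The target is the last element of \<open>u\<close>, which makes its concept
    exactly membership in \<open>u\<close>. Since \<open>u\<close> starts with \<open>s\<close>, the
    index is in range.\<close>
  let ?r = "list_order (u @ v)" and ?z = "(u @ v) ! (length u - 1)"
  obtain u' where u: "u = s # u'" using c by (auto simp: completes_def)
  have dist: "distinct (u @ v)" using c unfolding completes_def by blast
  have X: "set (u @ v) = insert s F" using completes_set(4)[OF c] by auto
  have con: "concept ?r ?z = (\<lambda>a. a \<in> set u)"
    using concept_list_order[OF dist, of "length u - 1"] u by simp
  have "enat (card F) \<le> enat (mistakes (run x T (concept ?r ?z) (max_oracle (u @ v)) A n)) +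
        enat (calls (run x T (concept ?r ?z) (max_oracle (u @ v)) A n))"
    using cost con by simp
  \<comment> \<open>The two totals are suprema over all stages, so the single stage \<open>n\<close>
    bounds both from below.\<close>
  also have "\<dots> \<le> total_mistakes x T (concept ?r ?z) (max_oracle (u @ v)) A +
      total_calls x T (concept ?r ?z) (max_oracle (u @ v)) A"
    unfolding total_mistakes_def total_calls_def by (intro add_mono SUP_upper) auto
  finally have "enat (card F) \<le> \<dots>" .
  moreover have "linear_order_on (insert s F) ?r"
    using linear_order_on_list_order[OF dist] X by simp
  moreover have "\<forall>a\<in>insert s F. (s, a) \<in> ?r"
  proof
    fix a assume "a \<in> insert s F"
    then obtain j where "j < length (u @ v)" "a = (u @ v) ! j"
      using X by (metis in_set_conv_nth)
    moreover have "s = (u @ v) ! 0" using u by simp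
    ultimately show "(s, a) \<in> ?r" unfolding list_order_def by blast
  qed
  moreover have "?z \<in> insert s F"
    unfolding X[symmetric] by (rule nth_mem) (simp add: u)
  moreover have "legal_oracle (insert s F) ?r (max_oracle (u @ v))"
    using legal_max_oracle[OF dist] X by simp
  ultimately show ?thesis by blast
qed

section \<open>The lower bound in both conventions\<close>

lemma lower_bound_slack:
  assumes "T \<ge> 1" "distinct_instances conv x T"
  shows "lower_bound conv x T (slack conv)"
  unfolding lower_bound_def
proof (intro allI impI)
  fix A :: "'a learner"
  let ?X = "instance_space conv x T"
  obtain s F where sF: "?X = insert s F" "x ` {1..T} \<subseteq> insert s F" "F \<subseteq> x ` {1..T}" "s \<notin> F"
    "real (card F) = real T - slack conv" "\<And>s'. conv = Conv_E s' \<Longrightarrow> s' = s"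
  proof (cases conv)
    case (Conv_E s)
    have "inj_on x {1..T}" "s \<notin> x ` {1..T}" using assms(2) Conv_E by simp_all
    then show ?thesis
      using Conv_E by (intro that[of s "x ` {1..T}"]) (simp_all add: card_image subset_insertI)
  next
    case Conv_N
    \<comment> \<open>Without a sentinel, \<open>x 1\<close> takes its place at the bottom of the
      order; this is the one instance lost in the bound.\<close>
    have x1: "x 1 \<in> x ` {1..T}" using assms(1) by (intro imageI) simp
    define F where "F = x ` {1..T} - {x 1}"
    have "card (x ` {1..T}) = T" using assms(2) Conv_N by (simp add: card_image)
    then have "card F = T - 1" unfolding F_def using x1 card_Diff_singleton by metis
    then have "real (card F) = real T - 1" using assms(1) by simp
    moreover have "insert (x 1) F = x ` {1..T}" "F \<subseteq> x ` {1..T}" "x 1 \<notin> F"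
      using x1 by (auto simp: F_def)
    ultimately show ?thesis
      using Conv_N by (intro that[of "x 1" F]) simp_all
  qed
  obtain r z Orc where r: "linear_order_on ?X r" "\<forall>a\<in>?X. (s, a) \<in> r"
    and zO: "z \<in> ?X" "legal_oracle ?X r Orc"
    and cost: "enat (card F) \<le> total_mistakes x T (concept r z) Orc A + total_calls x T (concept r z) Orc A"
    using adversary_instance[OF sF(2-4), of A, folded sF(1)] by blast
  have "admissible_order conv x T r"
  proof (cases conv)
    case (Conv_E s')
    then show ?thesis using r sF(6)[OF Conv_E] by simp
  next
    case Conv_N
    then show ?thesis using r by simp
  qed
  moreover have "ereal (real T - slack conv) \<le>
      ereal_of_enat (total_mistakes x T (concept r z) Orc A + total_calls x T (concept r z) Orc A)"
  proof -
    have "ereal (real T - slack conv) = ereal_of_enat (enat (card F))"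
      by (simp add: sF(5))
    also have "\<dots> \<le> ereal_of_enat
        (total_mistakes x T (concept r z) Orc A + total_calls x T (concept r z) Orc A)"
      using cost by (simp only: ereal_of_enat_le_iff)
    finally show ?thesis .
  qed
  ultimately show "\<exists>r z Orc. admissible_order conv x T r \<and> z \<in> ?X \<and> legal_oracle ?X r Orc \<and>
      ereal (real T - slack conv) \<le>
      ereal_of_enat (total_mistakes x T (concept r z) Orc A + total_calls x T (concept r z) Orc A)"
    using zO by blast
qed

section \<open>Sharpness of the constant\<close>

lemma run_always_predict:
  "run x (Suc 0) c Orc (\<lambda>_. Predict True) n = (if n = 0 then [] else [Round True (c (x (Suc 0)))])"
  by (induction n) (auto simp: run_def step_def)

text \<open>One round suffices, against the learner that predicts \<open>True\<close> and never
  calls the oracle. In convention N the only concept on \<open>{x 1}\<close> is positive there, so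
  the cost is zero; in convention E it is at most one.\<close>

lemma not_lower_bound:
  assumes "\<epsilon> < slack conv"
  shows "\<not> lower_bound conv x 1 \<epsilon>"
proof
  let ?A = "\<lambda>_. Predict True"
  let ?cost = "\<lambda>r z Orc. total_mistakes x 1 (concept r z) Orc ?A + total_calls x 1 (concept r z) Orc ?A"
  assume "lower_bound conv x 1 \<epsilon>"
  moreover have "valid_learner (instance_space conv x 1) ?A"
    by (simp add: valid_learner_def)
  ultimately have "\<exists>r z Orc. admissible_order conv x 1 r \<and> z \<in> instance_space conv x 1 \<and>
    legal_oracle (instance_space conv x 1) r Orc \<and> ereal (real 1 - \<epsilon>) \<le> ereal_of_enat (?cost r z Orc)"
    unfolding lower_bound_def by - (drule spec[of _ ?A], erule mp)
  then obtain r z Orc where adm: "admissible_order conv x 1 r" and z: "z \<in> instance_space conv x 1"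
    and lb: "ereal (real 1 - \<epsilon>) \<le> ereal_of_enat (?cost r z Orc)"
    by blast
  \<comment> \<open>The largest possible cost of this learner, which equals
    \<open>1 - slack conv\<close> and so falls below \<open>1 - \<epsilon>\<close>.\<close>
  define k where "k = (case conv of Conv_E s \<Rightarrow> 1 | Conv_N \<Rightarrow> (0::nat))"
  have k: "real k = 1 - slack conv"
    by (cases conv) (simp_all add: k_def)
  have N: "concept r z (x 1)" if "conv = Conv_N"
  proof -
    have "refl_on {x 1} r" "z = x 1"
      using adm z that
      by (simp_all add: linear_order_on_def partial_order_on_def preorder_on_def)
    then show ?thesis by (simp add: concept_def refl_on_def)
  qed
  have "mistakes (run x 1 (concept r z) Orc ?A n) \<le> k" for n
    using N by (cases conv) (simp_all add: run_always_predict k_def)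
  then have "total_mistakes x 1 (concept r z) Orc ?A \<le> enat k"
    unfolding total_mistakes_def by (intro SUP_least) simp
  moreover have "calls (run x 1 (concept r z) Orc ?A n) = 0" for n
    by (simp add: run_always_predict)
  then have "total_calls x 1 (concept r z) Orc ?A = 0"
    by (simp add: total_calls_def zero_enat_def)
  ultimately have "?cost r z Orc \<le> enat k"
    by simp
  then have "ereal_of_enat (?cost r z Orc) \<le> ereal_of_enat (enat k)"
    by (simp only: ereal_of_enat_le_iff)
  also have "\<dots> = ereal (real k)" by simp
  finally have "ereal (real 1 - \<epsilon>) \<le> ereal (real k)"
    using lb order_trans by blast
  then show False using assms k by simp
qed

theorem theorem4p1:
  fixes conv :: "'a convention" and x :: "nat \<Rightarrow> 'a"
  shows "(\<forall>T\<ge>1. distinct_instances conv x T \<longrightarrow> lower_bound conv x T (slack conv)) \<and>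
         ((\<forall>T\<ge>1. distinct_instances conv x T) \<longrightarrow>
            (\<forall>\<epsilon>'<slack conv. \<not> (\<forall>T\<ge>1. lower_bound conv x T \<epsilon>')))"
proof (intro conjI allI impI)
  fix T :: nat assume "1 \<le> T" "distinct_instances conv x T"
  then show "lower_bound conv x T (slack conv)" by (rule lower_bound_slack)
next
  fix \<epsilon>' assume "\<epsilon>' < slack conv"
  then have "\<not> lower_bound conv x 1 \<epsilon>'" by (rule not_lower_bound)
  then show "\<not> (\<forall>T\<ge>1. lower_bound conv x T \<epsilon>')" by blast
qed

end
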